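(* Let $g\in\mathcal G$, let $\nu(g)=\mathrm E[g(U)]$ with $U\sim\mathcal U[0,1]$, and let $$\widehat m_0(p_1,\dots,p_m)=\frac1{\nu(g)}\Big(1+\sum_{i=1}^m g(p_i)\Big).$$ Define the rescaled estimator $$\widehat m_0^{\mathrm{resc}}(p_1,\dots,p_m)=\frac{1}{\min(\nu_1^{\mathrm{resc}},\dots,\nu_m^{\mathrm{resc}})}+\sum_{i=1}^m\frac{g(p_i)}{\nu_i^{\mathrm{resc}}},$$ where $\nu_i^{\mathrm{resc}}=\mathrm E_{p_i\sim F_i}[g(p_i)]$ is the expectation of the transformed $p$-value taken with respect to $F_i$. Then the plug-in BH procedure using $\widehat m_0^{\mathrm{resc}}$ controls the FDR at level $\alpha$, and $\widehat m_0^{\mathrm{resc}}\le\widehat m_0$ almost surely.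
   Context: Setting: an observation $X$ has distribution $P$ belonging to a set $\mathcal P$ of possible distributions. There are $m$ null hypotheses $H_{0,1},\dots,H_{0,m}$ on $P$; $\mathcal H_0(P)\subseteq\{1,\dots,m\}$ is the set of indices $i$ such that $H_{0,i}$ is satisfied by $P$. The $p$-values are $[0,1]$-valued random variables $p_i=p_i(X)$. Put $F_i(t)=\sup_{P\in\mathcal P:\, i\in\mathcal H_0(P)}\mathbf P_{X\sim P}(p_i(X)\le t)$, $t\in[0,1]$. Standing assumptions: (i) for every $P\in\mathcal P$ the $p$-values $p_1,\dots,p_m$ are mutually independent; (ii) each $F_i$ is a known cumulative distribution function of a discrete distribution with finite support $\mathcal S_i\subset(0,1]$ (a right-continuous step function jumping only at points of $\mathcal S_i$); (iii) super-uniformity: $F_i(t)\le t$ for all $t\in[0,1]$ and all $i$. $\mathcal U[0,1]$ is the uniform distribution on $[0,1]$. $\mathcal G$ is the set of all non-decreasing functions $g:[0,1]\to[0,1]$ with $\mathrm E[g(U)]>0$ for $U\sim\mathcal U[0,1]$. Plug-in BH procedure at level $\alpha\in(0,1)$ with estimator $\widehat m=\widehat m(p_1,\dots,p_m)$: let $p_{(1)}\le\dots\le p_{(m)}$ be the ordered $p$-values with corresponding null hypotheses $H_{(1)},\dots,H_{(m)}$, and $p_{(0)}:=0$; reject $H_{(1)},\dots,H_{(\hat k)}$, where $\hat k=\max\{\ell\in\{0,\dots,m\}: p_{(\ell)}\le \ell\alpha/\widehat m\}$. FDR is the expectation of the number of rejected true null hypotheses divided by $\max(1,\text{number of rejections})$.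 Controlling the FDR at level $\alpha$ means that this expectation is $\le\alpha$ for every $P\in\mathcal P$. *)

theory Defs
  imports "HOL-Probability.Probability"
begin

type_synonym pvec = "nat \<Rightarrow> real"  \<comment> \<open>only the indices \<open>1, \<dots>, m\<close> are meaningful\<close>

text \<open>\<open>H i P\<close> says that the distribution \<open>P\<close> satisfies the \<open>i\<close>-th null hypothesis.\<close>

definition true_nulls :: "nat \<Rightarrow> (nat \<Rightarrow> 'x measure \<Rightarrow> bool) \<Rightarrow> 'x measure \<Rightarrow> nat set" where
  "true_nulls m H P = {i \<in> {1..m}. H i P}"

definition null_cdf ::
  "'x measure set \<Rightarrow> nat \<Rightarrow> (nat \<Rightarrow> 'x measure \<Rightarrow> bool) \<Rightarrow> (nat \<Rightarrow> 'x \<Rightarrow> real) \<Rightarrow> nat \<Rightarrow> real \<Rightarrow> real"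
  where
  "null_cdf \<P> m H p i t =
     (SUP P \<in> {P \<in> \<P>. i \<in> true_nulls m H P}. measure P {x \<in> space P. p i x \<le> t})"

text \<open>The distribution is carried by \<open>[0,1]\<close>, so that expectations do not depend on the
  values, or the measurability, of a function outside that interval.\<close>

definition unif01 :: "real measure" where
  "unif01 = restrict_space (uniform_measure lborel {0..1}) {0..1}"

definition nu :: "(real \<Rightarrow> real) \<Rightarrow> real" where
  "nu g = (\<integral>u. g u \<partial>unif01)"

definition classG :: "(real \<Rightarrow> real) set" where
  "classG = {g. g \<in> {0..1} \<rightarrow> {0..1} \<and> mono_on {0..1} g \<and> nu g > 0}"

definition m0_hat :: "(real \<Rightarrow> real) \<Rightarrow> nat \<Rightarrow> pvec \<Rightarrow> real" where
  "m0_hat g m v = 1 / nu g * (1 + (\<Sum>i=1..m. g (v i)))"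

text \<open>\<open>D i\<close> is the discrete distribution whose distribution function is \<open>F\<^sub>i\<close>.\<close>

definition nu_resc :: "(real \<Rightarrow> real) \<Rightarrow> (nat \<Rightarrow> real pmf) \<Rightarrow> nat \<Rightarrow> real" where
  "nu_resc g D i = measure_pmf.expectation (D i) g"

definition m0_resc :: "(real \<Rightarrow> real) \<Rightarrow> (nat \<Rightarrow> real pmf) \<Rightarrow> nat \<Rightarrow> pvec \<Rightarrow> real" where
  "m0_resc g D m v =
     1 / Min (nu_resc g D ` {1..m}) + (\<Sum>i=1..m. g (v i) / nu_resc g D i)"

text \<open>The sort is stable: ties between p-values are broken by the smaller index.\<close>

definition ordered_hyps :: "nat \<Rightarrow> pvec \<Rightarrow> nat list" where
  "ordered_hyps m v = sort_key v [1..<Suc m]"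

definition ordered_pval :: "nat \<Rightarrow> pvec \<Rightarrow> nat \<Rightarrow> real" where
  "ordered_pval m v l = (if l = 0 then 0 else v (ordered_hyps m v ! (l - 1)))"

definition bh_count :: "nat \<Rightarrow> real \<Rightarrow> (pvec \<Rightarrow> real) \<Rightarrow> pvec \<Rightarrow> nat" where
  "bh_count m \<alpha> mhat v = Max {l \<in> {0..m}. ordered_pval m v l \<le> real l * \<alpha> / mhat v}"

definition bh_rejected :: "nat \<Rightarrow> real \<Rightarrow> (pvec \<Rightarrow> real) \<Rightarrow> pvec \<Rightarrow> nat set" where
  "bh_rejected m \<alpha> mhat v = set (take (bh_count m \<alpha> mhat v) (ordered_hyps m v))"

definition fdp :: "nat set \<Rightarrow> nat set \<Rightarrow> real" where
  "fdp T R = real (card (R \<inter> T)) / real (max 1 (card R))"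

text \<open>Integrability is demanded because the Bochner integral of a function that is not
  integrable is \<open>0\<close> by convention, which would make the bound vacuous.\<close>

definition controls_FDR ::
  "'x measure set \<Rightarrow> nat \<Rightarrow> (nat \<Rightarrow> 'x measure \<Rightarrow> bool) \<Rightarrow> (nat \<Rightarrow> 'x \<Rightarrow> real) \<Rightarrow>
   (pvec \<Rightarrow> nat set) \<Rightarrow> real \<Rightarrow> bool" where
  "controls_FDR \<P> m H p R \<alpha> \<longleftrightarrow>
     (\<forall>P\<in>\<P>. integrable P (\<lambda>x. fdp (true_nulls m H P) (R (\<lambda>i. p i x))) \<and>
             (\<integral>x. fdp (true_nulls m H P) (R (\<lambda>i. p i x)) \<partial>P) \<le> \<alpha>)"

end

(*
  Write Y_i = g(p_i) / nu_i and B = 1 / min nu_i, so that the estimator is B + sum_j Y_j with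
  0 <= Y_i <= B. It is non-decreasing in each p-value, so for fixed (p_j)_{j ~= i} the ratio of the
  number of rejections to the estimator is non-increasing in p_i. Super-uniformity of a null p_i
  then bounds the i-th contribution to the FDR by alpha * E[1 / (B + sum_{j ~= i} Y_j)].
  The law of a null p_i stochastically dominates F_i, so E[Y_i] >= 1, and by independence the
  bound is at most alpha * E[Y_i / (B + sum_{j ~= i} Y_j)]. As Y_i <= B, each denominator is at
  least sum_j Y_j, and these terms add up to at most alpha.

  Similarly F_i dominates the uniform distribution, so nu_i >= nu(g), which compares the two
  estimators.
*)
theory Submission imports Defs begin

section \<open>Stochastic domination\<close>

text \<open>A lower set of reals is empty, the whole line, or a left half-line. A closed half-line
  is measured by the cdf itself, an open one by its left limit, so the order of the cdfs carries
  over.\<close>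

lemma measure_lower_set_le_of_cdf_le:
  assumes "real_distribution M1" "real_distribution M2"
    and cdf: "\<And>t. cdf M1 t \<le> cdf M2 t"
    and lower: "\<And>x y. y \<in> L \<Longrightarrow> x \<le> y \<Longrightarrow> x \<in> L"
  shows "measure M1 L \<le> measure M2 L"
proof -
  interpret M1: real_distribution M1 by fact
  interpret M2: real_distribution M2 by fact
  consider a where "L = {..a}" | a where "L = {..<a}" | "L = {}" | "L = UNIV"
  proof (cases "L = {} \<or> \<not> bdd_above L")
    case True
    have "x \<in> L" if "\<not> bdd_above L" for x
      using that lower[of _ x] by (meson bdd_above.I linear)
    with True have "L = {} \<or> L = UNIV"
      by fast
    then show ?thesis
      using that by blast
  next
    case False
    have "x \<le> Sup L" if "x \<in> L" for x
      using False that by (simp add: cSup_upper)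
    moreover have "x \<in> L" if "x < Sup L" for x
      using False that lower[of _ x] by (metis less_cSup_iff less_imp_le)
    ultimately have "L = {..Sup L} \<or> L = {..<Sup L}"
      by (auto simp: set_eq_iff less_le)
    then show ?thesis
      using that by blast
  qed
  then show ?thesis
  proof cases
    case (1 a)
    then show ?thesis using cdf[of a] by (simp add: cdf_def)
  next
    case (2 a)
    have "measure M1 {..<a} \<le> measure M2 {..<a}"
      by (rule tendsto_le[OF _ M2.cdf_at_left M1.cdf_at_left]) (auto simp: cdf)
    then show ?thesis by (simp add: 2)
  next
    case 4
    then show ?thesis
      using M1.prob_space M2.prob_space by simp
  qed simp
qed

text \<open>\<open>G x\<close> is the length of \<open>{0..<G x}\<close>; exchanging the two
  integrals leaves the mass of the upper level sets. Integrals can then be compared level by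
  level.\<close>

lemma (in real_distribution) nn_integral_layer_cake:
  assumes [measurable]: "G \<in> borel_measurable borel" and "\<And>x. 0 \<le> G x"
  shows "(\<integral>\<^sup>+x. ennreal (G x) \<partial>M) = (\<integral>\<^sup>+s. emeasure M {x. s < G x} * indicator {0..} s \<partial>lborel)"
proof -
  interpret pair_sigma_finite M lborel
    by unfold_locales
  have "(\<integral>\<^sup>+x. ennreal (G x) \<partial>M) = (\<integral>\<^sup>+x. (\<integral>\<^sup>+s. indicator {0..<G x} s \<partial>lborel) \<partial>M)"
    using assms by (intro nn_integral_cong) simp
  also have "\<dots> = (\<integral>\<^sup>+x. (\<integral>\<^sup>+s. (if 0 \<le> s \<and> s < G x then 1 else 0) \<partial>lborel) \<partial>M)"
    by (intro nn_integral_cong) (simp add: indicator_def)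
  also have "\<dots> = (\<integral>\<^sup>+s. (\<integral>\<^sup>+x. (if 0 \<le> s \<and> s < G x then 1 else 0) \<partial>M) \<partial>lborel)"
    by (rule Fubini'[symmetric]) measurable
  also have "\<dots> = (\<integral>\<^sup>+s. emeasure M {x. s < G x} * indicator {0..} s \<partial>lborel)"
  proof (intro nn_integral_cong)
    fix s :: real
    have [measurable]: "{x. s < G x} \<in> sets M"
      by measurable
    have "(\<integral>\<^sup>+x. (if 0 \<le> s \<and> s < G x then 1 else 0) \<partial>M)
        = (\<integral>\<^sup>+x. indicator {0..} s * indicator {x. s < G x} x \<partial>M)"
      by (intro nn_integral_cong) (simp add: indicator_def)
    also have "\<dots> = emeasure M {x. s < G x} * indicator {0..} s"
      by (subst nn_integral_cmult) (simp_all add: mult.commute)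
    finally show "(\<integral>\<^sup>+x. (if 0 \<le> s \<and> s < G x then 1 else 0) \<partial>M) = \<dots>" .
  qed
  finally show ?thesis .
qed

text \<open>The complement of an upper level set of a monotone \<open>G\<close> is a lower set, so
  the level sets are ordered in mass and the layer-cake formula orders the integrals. The bounds on
  \<open>G\<close> give integrability under both laws.\<close>

lemma integral_le_of_cdf_le:
  fixes G :: "real \<Rightarrow> real"
  assumes "real_distribution M1" "real_distribution M2"
    and cdf: "\<And>t. cdf M1 t \<le> cdf M2 t"
    and "mono G" and nonneg: "\<And>x. 0 \<le> G x" and le_1: "\<And>x. G x \<le> 1"
  shows "(\<integral>x. G x \<partial>M2) \<le> (\<integral>x. G x \<partial>M1)"
proof -
  interpret M1: real_distribution M1 by fact
  interpret M2: real_distribution M2 by fact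
  have G [measurable]: "G \<in> borel_measurable borel"
    using \<open>mono G\<close> by (rule borel_measurable_mono)
  have "emeasure M2 {x. s < G x} \<le> emeasure M1 {x. s < G x}" for s
  proof -
    define L where "L = {x. \<not> s < G x}"
    have [measurable]: "L \<in> sets borel"
      unfolding L_def by measurable
    have "{x. s < G x} = space M1 - L" "{x. s < G x} = space M2 - L"
      by (auto simp: L_def)
    moreover have "measure M1 L \<le> measure M2 L"
      by (rule measure_lower_set_le_of_cdf_le[OF assms(1,2) cdf])
        (use monoD[OF \<open>mono G\<close>] in \<open>fastforce simp: L_def\<close>)
    ultimately show ?thesis
      by (metis M1.emeasure_eq_measure M1.events_eq_borel M1.prob_compl M2.emeasure_eq_measure
          M2.events_eq_borel M2.prob_compl \<open>L \<in> sets borel\<close> diff_left_mono ennreal_leI)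
  qed
  then have "(\<integral>\<^sup>+x. ennreal (G x) \<partial>M2) \<le> (\<integral>\<^sup>+x. ennreal (G x) \<partial>M1)"
    using nonneg by (simp add: M1.nn_integral_layer_cake M2.nn_integral_layer_cake
        nn_integral_mono mult_right_mono)
  moreover have "integrable M1 G" "integrable M2 G"
    using nonneg le_1
    by (auto intro!: M1.integrable_const_bound[where B=1] M2.integrable_const_bound[where B=1])
  ultimately show ?thesis
    using nonneg by (simp add: nn_integral_eq_integral ennreal_le_iff integral_nonneg_AE)
qed

section \<open>The step-up procedure\<close>

text \<open>The entries at most \<open>c\<close> fill an initial segment of a sorted list. Positions
  count from 0, so position \<open>l\<close> lies in it exactly when its length is at least
  \<open>Suc l\<close>.\<close>

lemma sorted_nth_le_iff:
  fixes xs :: "'a :: linorder list"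
  assumes "sorted xs" "l < length xs"
  shows "xs ! l \<le> c \<longleftrightarrow> Suc l \<le> length (filter (\<lambda>x. x \<le> c) xs)"
proof -
  define A where "A = {i. i < length xs \<and> xs ! i \<le> c}"
  have card: "length (filter (\<lambda>x. x \<le> c) xs) = card A"
    unfolding A_def by (rule length_filter_conv_card)
  have "finite A"
    by (simp add: A_def)
  show ?thesis
  proof
    assume "xs ! l \<le> c"
    then have "{..l} \<subseteq> A"
      using assms(2) sorted_nth_mono[OF assms(1) _ assms(2)] by (fastforce simp: A_def)
    then show "Suc l \<le> length (filter (\<lambda>x. x \<le> c) xs)"
      using card_mono[OF \<open>finite A\<close>, of "{..l}"] by (simp add: card)
  next
    assume le: "Suc l \<le> length (filter (\<lambda>x. x \<le> c) xs)"
    show "xs ! l \<le> c"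
    proof (rule ccontr)
      assume "\<not> xs ! l \<le> c"
      have "i < l" if "i \<in> A" for i
      proof (rule ccontr)
        assume "\<not> i < l"
        then have "xs ! l \<le> xs ! i"
          using that by (intro sorted_nth_mono[OF assms(1)]) (simp_all add: A_def)
        then show False
          using that \<open>\<not> xs ! l \<le> c\<close> by (auto simp: A_def dest: order_trans)
      qed
      then have "A \<subseteq> {..<l}"
        by blast
      then have "card A \<le> l"
        using card_mono[of "{..<l}" A] by simp
      then show False
        using le card by simp
    qed
  qed
qed

lemma
  shows distinct_ordered_hyps: "distinct (ordered_hyps m v)"
    and set_ordered_hyps: "set (ordered_hyps m v) = {1..m}"
    and length_ordered_hyps: "length (ordered_hyps m v) = m"
    and sorted_ordered_hyps: "sorted (map v (ordered_hyps m v))"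
  by (auto simp: ordered_hyps_def)

text \<open>Replaces order statistics by counts, for which ties and the sorting no longer
  matter.\<close>

lemma ordered_pval_le_iff:
  assumes "0 < l" "l \<le> m"
  shows "ordered_pval m v l \<le> c \<longleftrightarrow> l \<le> card {j \<in> {1..m}. v j \<le> c}"
proof -
  have "length (filter (\<lambda>x. x \<le> c) (map v (ordered_hyps m v)))
      = length (filter (\<lambda>j. v j \<le> c) (ordered_hyps m v))"
    by (simp add: filter_map o_def)
  also have "\<dots> = card (set (filter (\<lambda>j. v j \<le> c) (ordered_hyps m v)))"
    by (metis distinct_card distinct_filter distinct_ordered_hyps)
  also have "set (filter (\<lambda>j. v j \<le> c) (ordered_hyps m v)) = {j \<in> {1..m}. v j \<le> c}"
    by (simp add: set_ordered_hyps)
  finally show ?thesis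
    using sorted_nth_le_iff[OF sorted_ordered_hyps[of v m], of "l - 1" c] assms
    by (simp add: ordered_pval_def length_ordered_hyps)
qed

text \<open>A description free of sorting, from which monotonicity and measurability of the count
  can be read off. At \<open>l = 0\<close> both conditions hold: the threshold is 0, and so is
  \<open>ordered_pval m v 0\<close>.\<close>

lemma bh_count_eq:
  assumes "0 < \<alpha>" "0 < mhat v"
  shows "bh_count m \<alpha> mhat v
    = Max {l. l \<le> m \<and> l \<le> card {j \<in> {1..m}. v j \<le> real l * \<alpha> / mhat v}}"
proof -
  have "(ordered_pval m v l \<le> c) = (l \<le> card {j \<in> {1..m}. v j \<le> c})"
    if "l \<le> m" "c = real l * \<alpha> / mhat v" for l c
  proof (cases "l = 0")
    case True
    then show ?thesis using that by (simp add: ordered_pval_def)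
  qed (use that ordered_pval_le_iff in simp)
  then show ?thesis
    unfolding bh_count_def by (intro arg_cong[where f=Max]) auto
qed

lemma
  assumes "0 < \<alpha>" "0 < mhat v"
  shows bh_count_le: "bh_count m \<alpha> mhat v \<le> m"
    and bh_count_le_card:
      "bh_count m \<alpha> mhat v \<le> card {j \<in> {1..m}. v j \<le> real (bh_count m \<alpha> mhat v) * \<alpha> / mhat v}"
proof -
  let ?S = "{l. l \<le> m \<and> l \<le> card {j \<in> {1..m}. v j \<le> real l * \<alpha> / mhat v}}"
  have "finite ?S" "0 \<in> ?S"
    by auto
  then have "Max ?S \<in> ?S"
    by (intro Max_in) auto
  then show "bh_count m \<alpha> mhat v \<le> m"
    "bh_count m \<alpha> mhat v \<le> card {j \<in> {1..m}. v j \<le> real (bh_count m \<alpha> mhat v) * \<alpha> / mhat v}"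
    unfolding bh_count_eq[where mhat=mhat, OF assms] by auto
qed

lemma bh_count_greatest:
  assumes "0 < \<alpha>" "0 < mhat v"
    and "l \<le> card {j \<in> {1..m}. v j \<le> real l * \<alpha> / mhat v}"
  shows "l \<le> bh_count m \<alpha> mhat v"
proof -
  have "l \<le> m"
    using assms(3) card_mono[of "{1..m}" "{j \<in> {1..m}. v j \<le> real l * \<alpha> / mhat v}"] by fastforce
  then show ?thesis
    unfolding bh_count_eq[where mhat=mhat, OF assms(1,2)] using assms(3) by (intro Max_ge) auto
qed

lemma card_bh_rejected:
  assumes "0 < \<alpha>" "0 < mhat v"
  shows "card (bh_rejected m \<alpha> mhat v) = bh_count m \<alpha> mhat v"
proof -
  have "distinct (take (bh_count m \<alpha> mhat v) (ordered_hyps m v))"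
    by (simp add: distinct_ordered_hyps)
  then show ?thesis
    unfolding bh_rejected_def
    using bh_count_le[of \<alpha> mhat v m] assms by (simp add: distinct_card length_ordered_hyps)
qed

text \<open>The first \<open>bh_count\<close> ordered p-values lie below the threshold. If a further
  one did, the next larger count would also qualify, its threshold being no smaller, against
  maximality. Hence tie-breaking does not affect the rejected set.\<close>

lemma bh_rejected_eq:
  assumes "0 < \<alpha>" "0 < mhat v"
  shows "bh_rejected m \<alpha> mhat v
    = {j \<in> {1..m}. v j \<le> real (bh_count m \<alpha> mhat v) * \<alpha> / mhat v}" (is "_ = ?A")
proof (rule card_seteq)
  let ?k = "bh_count m \<alpha> mhat v"
  show "finite ?A"
    by simp
  have k: "?k \<le> m" "?k \<le> card ?A"
    by (rule bh_count_le[where mhat=mhat, OF assms],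
        rule bh_count_le_card[where mhat=mhat, OF assms])
  show "bh_rejected m \<alpha> mhat v \<subseteq> ?A"
  proof
    fix j assume "j \<in> bh_rejected m \<alpha> mhat v"
    then obtain i where i: "i < ?k" "j = ordered_hyps m v ! i"
      unfolding bh_rejected_def using k
      by (metis in_set_conv_nth length_ordered_hyps length_take min.absorb2 nth_take)
    \<comment> \<open>\<open>ordered_hyps\<close> is indexed from 0, so the last rejected hypothesis
      sits at position \<open>?k - 1\<close>.\<close>
    have "v j \<le> ordered_pval m v ?k"
      using sorted_nth_mono[OF sorted_ordered_hyps[of v m], of i "?k - 1"] i k
      by (simp add: ordered_pval_def length_ordered_hyps)
    also have "\<dots> \<le> real ?k * \<alpha> / mhat v"
      using i k by (subst ordered_pval_le_iff) auto
    finally show "j \<in> ?A"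
      using i k nth_mem[of i "ordered_hyps m v"] by (simp add: length_ordered_hyps set_ordered_hyps)
  qed
  show "card ?A \<le> card (bh_rejected m \<alpha> mhat v)"
  proof (rule ccontr)
    assume "\<not> ?thesis"
    then have "Suc ?k \<le> card ?A"
      by (simp add: card_bh_rejected assms)
    also have "\<dots> \<le> card {j \<in> {1..m}. v j \<le> real (Suc ?k) * \<alpha> / mhat v}"
    proof (intro card_mono)
      have "real ?k * \<alpha> / mhat v \<le> real (Suc ?k) * \<alpha> / mhat v"
        using assms by (intro divide_right_mono mult_right_mono) auto
      then show "?A \<subseteq> {j \<in> {1..m}. v j \<le> real (Suc ?k) * \<alpha> / mhat v}"
        by auto
    qed simp
    finally show False
      using bh_count_greatest[of \<alpha> mhat v "Suc ?k" m] assms by simp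
  qed
qed

text \<open>The count attained at \<open>w\<close> still qualifies at \<open>v\<close>: lower
  p-values and a larger threshold only enlarge the counted set.\<close>

lemma bh_count_antimono:
  assumes "0 < \<alpha>" "0 < mhat v" "mhat v \<le> mhat w" "\<And>j. j \<in> {1..m} \<Longrightarrow> v j \<le> w j"
  shows "bh_count m \<alpha> mhat w \<le> bh_count m \<alpha> mhat v"
proof (rule bh_count_greatest)
  let ?k = "bh_count m \<alpha> mhat w"
  have "0 < mhat w"
    using assms by linarith
  then have "?k \<le> card {j \<in> {1..m}. w j \<le> real ?k * \<alpha> / mhat w}"
    by (rule bh_count_le_card[where mhat=mhat, OF \<open>0 < \<alpha>\<close>])
  also have "\<dots> \<le> card {j \<in> {1..m}. v j \<le> real ?k * \<alpha> / mhat v}"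
  proof (intro card_mono)
    have "real ?k * \<alpha> / mhat w \<le> real ?k * \<alpha> / mhat v"
      using assms by (intro divide_left_mono) auto
    then show "{j \<in> {1..m}. w j \<le> real ?k * \<alpha> / mhat w}
        \<subseteq> {j \<in> {1..m}. v j \<le> real ?k * \<alpha> / mhat v}"
      using assms(4) by fastforce
  qed simp
  finally show "?k \<le> card {j \<in> {1..m}. v j \<le> real ?k * \<alpha> / mhat v}" .
qed (use assms in auto)

text \<open>Splits the false discovery proportion into contributions of single nulls. Without
  rejections both sides are 0, as \<open>1 / 0 = 0\<close>, so \<open>max 1\<close>
  disappears.\<close>

lemma fdp_bh_rejected:
  assumes "0 < \<alpha>" "0 < mhat v" "T \<subseteq> {1..m}"
  shows "fdp T (bh_rejected m \<alpha> mhat v)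
    = (\<Sum>i\<in>T. if v i \<le> real (bh_count m \<alpha> mhat v) * \<alpha> / mhat v
                then 1 / real (bh_count m \<alpha> mhat v) else 0)"
    (is "_ = (\<Sum>i\<in>T. ?f i)")
proof -
  let ?k = "bh_count m \<alpha> mhat v" and ?R = "bh_rejected m \<alpha> mhat v"
  have "finite T"
    using assms(3) finite_subset by blast
  have "(\<Sum>i\<in>T. ?f i) = (\<Sum>i\<in>?R \<inter> T. 1 / real ?k)"
    using \<open>finite T\<close> assms
    by (intro sum.mono_neutral_cong_right) (auto simp: bh_rejected_eq)
  also have "\<dots> = fdp T ?R"
  proof (cases "?k = 0")
    case True
    then show ?thesis
      using card_bh_rejected[of \<alpha> mhat v m] assms by (simp add: fdp_def bh_rejected_def)
  next
    case False
    then have "max 1 ?k = ?k"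
      by simp
    then show ?thesis
      by (simp add: fdp_def card_bh_rejected assms)
  qed
  finally show ?thesis ..
qed

section \<open>Leave-one-out bound\<close>

text \<open>Points with \<open>k x = 0\<close> contribute nothing, as \<open>1 / 0 = 0\<close>.\<close>

lemma nn_integral_inverse_count_le:
  fixes k :: "real \<Rightarrow> nat" and M :: "real \<Rightarrow> real"
  assumes "real_distribution Q"
    and super: "\<And>t. 0 \<le> t \<Longrightarrow> measure Q {..t} \<le> t"
    and "antimono k" "mono M" "0 < c" and c: "\<And>x. c \<le> M x" and "0 < \<alpha>"
  shows "(\<integral>\<^sup>+x. ennreal (if x \<le> real (k x) * \<alpha> / M x then 1 / real (k x) else 0) \<partial>Q)
    \<le> ennreal (\<alpha> / c)"
proof -
  interpret Q: real_distribution Q by fact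
  \<comment> \<open>\<open>W\<close> is the rejection threshold as a function of the one free
    p-value, and \<open>A\<close> the set of its values that are rejected with a positive
    count.\<close>
  define W where "W = (\<lambda>x. real (k x) * \<alpha> / M x)"
  define A where "A = {x. k x \<noteq> 0 \<and> x \<le> W x}"
  have M_pos: "0 < M x" for x
    using c[of x] \<open>0 < c\<close> by linarith
  have W_anti: "W y \<le> W x" if "x \<le> y" for x y
    unfolding W_def using antimonoD[OF \<open>antimono k\<close> that] monoD[OF \<open>mono M\<close> that] M_pos \<open>0 < \<alpha>\<close>
    by (intro frac_le mult_right_mono) auto
  \<comment> \<open>Every rejected value lies below the threshold of every other one: if
    \<open>x \<le> y\<close> then \<open>x \<le> y \<le> W y\<close>, otherwise
    \<open>x \<le> W x \<le> W y\<close>. So super-uniformity bounds the mass of all of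
    \<open>A\<close> by each single threshold.\<close>
  have A_le: "x \<le> W y" if "x \<in> A" "y \<in> A" for x y
  proof (cases "x \<le> y")
    case False
    then show ?thesis
      using that W_anti[of y x] by (simp add: A_def)
  qed (use that in \<open>simp add: A_def\<close>)
  have W_pos: "0 < W x" if "x \<in> A" for x
    using that M_pos \<open>0 < \<alpha>\<close> by (simp add: A_def W_def)
  have A_lower: "x \<in> A" if "y \<in> A" "x \<le> y" for x y
    using that W_anti[OF that(2)] antimonoD[OF \<open>antimono k\<close> that(2)] by (auto simp: A_def)
  \<comment> \<open>A lower set is an interval, hence Borel.\<close>
  have "is_interval A"
    unfolding is_interval_1 using A_lower by blast
  then have [measurable]: "A \<in> sets borel"
    by (rule real_interval_borel_measurable)
  have prob_A: "measure Q A \<le> W x" if "x \<in> A" for x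
  proof -
    have "measure Q A \<le> measure Q {..W x}"
      using A_le that by (intro Q.finite_measure_mono) auto
    also have "\<dots> \<le> W x"
      using W_pos[OF that] by (intro super) simp
    finally show ?thesis .
  qed
  \<comment> \<open>The count in the threshold \<open>W x\<close> cancels against the division by
    \<open>k x\<close>, which leaves \<open>\<alpha> / M x\<close>.\<close>
  have bound: "measure Q A * (1 / real (k x)) \<le> \<alpha> / c" if "x \<in> A" for x
  proof -
    have "measure Q A * (1 / real (k x)) \<le> W x * (1 / real (k x))"
      using prob_A[OF that] by (intro mult_right_mono) auto
    also have "\<dots> = \<alpha> / M x"
      using that by (simp add: A_def W_def)
    also have "\<dots> \<le> \<alpha> / c"
      using c \<open>0 < c\<close> M_pos \<open>0 < \<alpha>\<close> by (intro divide_left_mono) auto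
    finally show ?thesis .
  qed
  have "(\<integral>\<^sup>+x. ennreal (if x \<le> W x then 1 / real (k x) else 0) \<partial>Q)
      = (\<integral>\<^sup>+x. ennreal (1 / real (k x)) * indicator A x \<partial>Q)"
    by (intro nn_integral_cong) (auto simp: A_def indicator_def)
  also have "\<dots> \<le> ennreal (\<alpha> / c)"
  \<comment> \<open>The pointwise bound on \<open>1 / k x\<close> divides by the mass of
    \<open>A\<close>, which integration over \<open>A\<close> multiplies back; mass 0 is therefore
    treated apart.\<close>
  proof (cases "measure Q A = 0")
    case True
    then have "AE x in Q. x \<notin> A"
      by (intro AE_not_in null_setsI) (simp_all add: Q.emeasure_eq_measure)
    then have "(\<integral>\<^sup>+x. ennreal (1 / real (k x)) * indicator A x \<partial>Q) = (\<integral>\<^sup>+x. 0 \<partial>Q)"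
      by (intro nn_integral_cong_AE) auto
    then show ?thesis
      by simp
  next
    case False
    then have pos: "0 < measure Q A"
      by (simp add: zero_less_measure_iff)
    have "(\<integral>\<^sup>+x. ennreal (1 / real (k x)) * indicator A x \<partial>Q)
        \<le> (\<integral>\<^sup>+x. ennreal (\<alpha> / c / measure Q A) * indicator A x \<partial>Q)"
    proof (intro nn_integral_mono)
      fix x
      have "1 / real (k x) \<le> \<alpha> / c / measure Q A" if "x \<in> A"
        using bound[OF that] pos by (subst pos_le_divide_eq) (simp_all add: mult.commute)
      then show "ennreal (1 / real (k x)) * indicator A x
          \<le> ennreal (\<alpha> / c / measure Q A) * indicator A x"
        by (auto simp: indicator_def intro!: ennreal_leI)
    qed
    also have "\<dots> = ennreal (\<alpha> / c / measure Q A) * ennreal (measure Q A)"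
      by (subst nn_integral_cmult_indicator) (simp_all add: Q.emeasure_eq_measure)
    also have "\<dots> = ennreal (\<alpha> / c)"
      using pos \<open>0 < \<alpha>\<close> \<open>0 < c\<close> by (simp add: ennreal_mult[symmetric])
    finally show ?thesis .
  qed
  finally show ?thesis
    by (simp add: W_def)
qed

text \<open>Since \<open>y i \<le> B\<close>, the denominator of each nonzero term is at least the
  full sum. If the full sum vanishes, all terms are 0.\<close>

lemma sum_leave_one_out_le_1:
  fixes y :: "'i \<Rightarrow> real"
  assumes "finite I" "0 < B" and y: "\<And>i. i \<in> I \<Longrightarrow> 0 \<le> y i" "\<And>i. i \<in> I \<Longrightarrow> y i \<le> B" and "T \<subseteq> I"
  shows "(\<Sum>i\<in>T. y i / (B + (\<Sum>j\<in>I - {i}. y j))) \<le> 1"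
proof -
  let ?S = "\<Sum>j\<in>I. y j"
  have le: "y i / (B + (\<Sum>j\<in>I - {i}. y j)) \<le> y i / ?S" if "i \<in> I" for i
  proof (cases "y i = 0")
    case False
    then have "0 < y i"
      using y that by (simp add: less_le)
    moreover have "?S = y i + (\<Sum>j\<in>I - {i}. y j)"
      using that \<open>finite I\<close> by (simp add: sum.remove)
    moreover have "0 \<le> (\<Sum>j\<in>I - {i}. y j)"
      using y by (intro sum_nonneg) auto
    ultimately show ?thesis
      using y(2)[OF that] by (intro divide_left_mono) auto
  qed simp
  have S_nonneg: "0 \<le> ?S"
    using y by (intro sum_nonneg) auto
  have "(\<Sum>i\<in>T. y i / (B + (\<Sum>j\<in>I - {i}. y j))) \<le> (\<Sum>i\<in>T. y i / ?S)"
    using le \<open>T \<subseteq> I\<close> by (intro sum_mono) auto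
  also have "\<dots> \<le> (\<Sum>i\<in>I. y i / ?S)"
    using assms S_nonneg by (intro sum_mono2) auto
  also have "\<dots> \<le> 1"
    by (simp add: sum_divide_distrib[symmetric])
  finally show ?thesis .
qed

text \<open>The FDR bound for general monotone transforms \<open>Y\<close> with values between 0 and
  \<open>B\<close> and null means at least 1; the rescaled estimator is an instance. Independence
  allows one p-value to be integrated out with the others fixed.\<close>

lemma (in prob_space) plug_in_bh_FDR_le:
  fixes p :: "nat \<Rightarrow> 'a \<Rightarrow> real" and Y :: "nat \<Rightarrow> real \<Rightarrow> real"
  assumes "1 \<le> m"
    and indep: "indep_vars (\<lambda>_. borel) p {1..m}"
    and Y_mono: "\<And>j. j \<in> {1..m} \<Longrightarrow> mono (Y j)"
    and Y_nonneg: "\<And>j x. j \<in> {1..m} \<Longrightarrow> 0 \<le> Y j x"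
    and Y_le: "\<And>j x. j \<in> {1..m} \<Longrightarrow> Y j x \<le> B"
    and "0 < B" "0 < \<alpha>" and T: "T \<subseteq> {1..m}"
    and super: "\<And>i t. i \<in> T \<Longrightarrow> 0 \<le> t \<Longrightarrow> prob {x \<in> space M. p i x \<le> t} \<le> t"
    and mean: "\<And>i. i \<in> T \<Longrightarrow> 1 \<le> expectation (\<lambda>x. Y i (p i x))"
    and mhat: "mhat = (\<lambda>v. B + (\<Sum>j=1..m. Y j (v j)))"
  shows "integrable M (\<lambda>x. fdp T (bh_rejected m \<alpha> mhat (\<lambda>i. p i x)))"
    and "expectation (\<lambda>x. fdp T (bh_rejected m \<alpha> mhat (\<lambda>i. p i x))) \<le> \<alpha>"
proof -
  define I where "I = {1..m}"
  \<comment> \<open>Coordinates outside \<open>I\<close> become the constant 0, since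
    \<open>product_prob_space\<close> wants a probability measure at every index.\<close>
  define q where "q = (\<lambda>i. if i \<in> I then p i else (\<lambda>_. 0))"
  define Q where "Q = (\<lambda>i. distr M borel (q i))"
  define k where "k = bh_count m \<alpha> mhat"
  \<comment> \<open>\<open>R i\<close> is the contribution of null \<open>i\<close> to the false
    discovery proportion; \<open>L i\<close> is the estimator without its \<open>i\<close>-th
    summand.\<close>
  define R where "R = (\<lambda>i v. if v i \<le> real (k v) * \<alpha> / mhat v then 1 / real (k v) else 0)"
  define L where "L = (\<lambda>i v. B + (\<Sum>j\<in>I - {i}. Y j (v j)))"
  have "finite I" "I \<noteq> {}"
    using \<open>1 \<le> m\<close> by (auto simp: I_def)
  have p [measurable]: "p i \<in> borel_measurable M" if "i \<in> I" for i
    using indep that by (auto simp: indep_vars_def I_def)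
  have q [measurable]: "q i \<in> borel_measurable M" for i
    by (simp add: q_def p)
  have Q_real: "real_distribution (Q i)" for i
    unfolding Q_def by (rule real_distribution_distr) simp
  have sets_Q [measurable_cong]: "sets (Q i) = sets borel" for i
    by (simp add: Q_def)
  interpret Q: product_prob_space Q I
    by (intro product_prob_spaceI) (simp add: Q_def prob_space_distr)
  have Y [measurable]: "Y j \<in> borel_measurable borel" if "j \<in> I" for j
    using Y_mono that by (intro borel_measurable_mono) (simp add: I_def)
  have law: "distr M (\<Pi>\<^sub>M i\<in>I. borel) (\<lambda>x. \<lambda>i\<in>I. p i x) = (\<Pi>\<^sub>M i\<in>I. Q i)"
  proof -
    have "distr M (\<Pi>\<^sub>M i\<in>I. borel) (\<lambda>x. \<lambda>i\<in>I. p i x) = (\<Pi>\<^sub>M i\<in>I. distr M borel (p i))"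
      using indep_vars_iff_distr_eq_PiM'[THEN iffD1, OF \<open>I \<noteq> {}\<close> p] indep by (simp add: I_def)
    also have "\<dots> = (\<Pi>\<^sub>M i\<in>I. Q i)"
      by (intro PiM_cong) (simp_all add: Q_def q_def)
    finally show ?thesis .
  qed

  have mhat_pos: "0 < mhat v" for v
    unfolding mhat using \<open>0 < B\<close> Y_nonneg by (intro add_pos_nonneg sum_nonneg)
  have L_pos: "0 < L i v" for i v
    unfolding L_def using \<open>0 < B\<close> Y_nonneg by (intro add_pos_nonneg sum_nonneg) (auto simp: I_def)
  have k_eq: "k v = Max {l. l \<le> m \<and> l \<le> card {j \<in> I. v j \<le> real l * \<alpha> / mhat v}}" for v
    unfolding k_def I_def by (rule bh_count_eq[where mhat=mhat, OF \<open>0 < \<alpha>\<close> mhat_pos])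
  have fdp_eq: "fdp T (bh_rejected m \<alpha> mhat v) = (\<Sum>i\<in>T. R i v)" for v
    unfolding R_def k_def by (rule fdp_bh_rejected[where mhat=mhat, OF \<open>0 < \<alpha>\<close> mhat_pos T])
  have mhat_cong: "mhat (restrict v I) = mhat v" for v
    by (simp add: mhat I_def)
  \<comment> \<open>Only coordinates in \<open>I\<close> matter, so \<open>R i\<close> can be
    evaluated at the restricted vectors on which the product measure lives.\<close>
  have R_cong: "R i (restrict v I) = R i v" if "i \<in> I" for i v
  proof -
    have "k (restrict v I) = k v"
      unfolding k_eq mhat_cong
      by (intro arg_cong[where f=Max] Collect_cong conj_cong refl arg_cong[where f="(\<le>) _"]
          arg_cong[where f=card]) simp
    then show ?thesis
      using that by (simp add: R_def mhat_cong)
  qed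
  have mhat_meas [measurable]: "mhat \<in> borel_measurable (\<Pi>\<^sub>M i\<in>I. borel)"
    unfolding mhat I_def[symmetric] by measurable
  have k_meas [measurable]: "k \<in> measurable (\<Pi>\<^sub>M i\<in>I. borel) (count_space UNIV)"
  proof -
    have "(\<lambda>v. card {j \<in> I. v j \<le> real l * \<alpha> / mhat v}) \<in> measurable (\<Pi>\<^sub>M i\<in>I. borel) (count_space UNIV)" for l
    proof (rule measurable_card)
      fix j
      show "{v \<in> space (\<Pi>\<^sub>M i\<in>I. borel). j \<in> {j \<in> I. v j \<le> real l * \<alpha> / mhat v}}
          \<in> sets (\<Pi>\<^sub>M i\<in>I. borel)"
        by (cases "j \<in> I") simp_all
    qed
    note [measurable] = this
    show ?thesis
      unfolding k_eq[abs_def] by measurable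
  qed
  have R_meas [measurable]: "R i \<in> borel_measurable (\<Pi>\<^sub>M i\<in>I. borel)" if [simp]: "i \<in> I" for i
    unfolding R_def by measurable
  have L_meas [measurable]: "L i \<in> borel_measurable (\<Pi>\<^sub>M i\<in>I. borel)" for i
    unfolding L_def by measurable
  have PiM_Q: "sets (\<Pi>\<^sub>M i\<in>I. Q i) = sets (\<Pi>\<^sub>M i\<in>I. borel)"
    by (intro sets_PiM_cong refl sets_Q)

  have main: "(\<integral>\<^sup>+v. ennreal (R i v) \<partial>(\<Pi>\<^sub>M i\<in>I. Q i))
      \<le> (\<integral>\<^sup>+v. ennreal (\<alpha> * (Y i (v i) / L i v)) \<partial>(\<Pi>\<^sub>M i\<in>I. Q i))" if "i \<in> T" for i
  proof -
    have i: "i \<in> I" "i \<in> {1..m}"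
      using that T by (auto simp: I_def)
    have ins: "insert i (I - {i}) = I"
      using i by blast
    \<comment> \<open>Coordinate \<open>i\<close> is integrated first, with the others fixed in
      \<open>w\<close>; this is where the product form of the joint law enters.\<close>
    have fubini: "(\<integral>\<^sup>+v. f v \<partial>(\<Pi>\<^sub>M i\<in>I. Q i))
        = (\<integral>\<^sup>+w. (\<integral>\<^sup>+x. f (w(i := x)) \<partial>Q i) \<partial>(\<Pi>\<^sub>M i\<in>I - {i}. Q i))"
      if "f \<in> borel_measurable (\<Pi>\<^sub>M i\<in>I. borel)" for f
      using Q.product_nn_integral_insert[of "I - {i}" i f] that \<open>finite I\<close>
      unfolding ins by (simp add: measurable_cong_sets[OF PiM_Q refl])
    have inner: "(\<integral>\<^sup>+x. ennreal (R i (w(i := x))) \<partial>Q i)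
        \<le> (\<integral>\<^sup>+x. ennreal (\<alpha> * (Y i ((w(i := x)) i) / L i (w(i := x)))) \<partial>Q i)" for w
    proof -
      \<comment> \<open>\<open>L i\<close> ignores coordinate \<open>i\<close>: in the inner
        integral it is a constant, and a positive lower bound for the estimator.\<close>
      have L_upd: "L i (w(i := x)) = L i w" for x
        by (simp add: L_def)
      have mhat_upd: "mhat (w(i := x)) = Y i x + L i w" for x
      proof -
        have "(\<Sum>j\<in>I. Y j ((w(i := x)) j)) = Y i x + (\<Sum>j\<in>I - {i}. Y j (w j))"
          using \<open>finite I\<close> i by (simp add: sum.remove)
        then show ?thesis
          unfolding mhat L_def I_def[symmetric] by simp
      qed
      have mono: "mono (\<lambda>x. mhat (w(i := x)))"
        unfolding mhat_upd using Y_mono[OF i(2)] by (auto simp: mono_def)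
      have "antimono (\<lambda>x. k (w(i := x)))"
        unfolding k_def
        by (intro antimonoI bh_count_antimono \<open>0 < \<alpha>\<close> mhat_pos monoD[OF mono]) auto
      moreover have "measure (Q i) {..t} \<le> t" if "0 \<le> t" for t
      proof -
        have "measure (Q i) {..t} = prob {x \<in> space M. p i x \<le> t}"
          using i by (simp add: Q_def measure_distr q_def vimage_def Int_def conj_commute)
        then show ?thesis
          using super[OF \<open>i \<in> T\<close> that] by simp
      qed
      ultimately have "(\<integral>\<^sup>+x. ennreal (R i (w(i := x))) \<partial>Q i) \<le> ennreal (\<alpha> / L i w)"
        using nn_integral_inverse_count_le[OF Q_real _ _ mono L_pos[of i w] _ \<open>0 < \<alpha>\<close>,
            where k="\<lambda>x. k (w(i := x))"] Y_nonneg[OF i(2)]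
        by (simp add: R_def mhat_upd)
      \<comment> \<open>The null mean of \<open>Y i\<close> is at least 1 and can be inserted as a
        factor; the constant \<open>\<alpha> / L i w\<close> then moves under the integral.\<close>
      also have "\<dots> \<le> ennreal (\<alpha> / L i w) * ennreal (\<integral>x. Y i x \<partial>Q i)"
      proof -
        have "(\<integral>x. Y i x \<partial>Q i) = expectation (\<lambda>x. Y i (p i x))"
          using i by (simp add: Q_def integral_distr q_def)
        then have "1 \<le> (\<integral>x. Y i x \<partial>Q i)"
          using mean[OF \<open>i \<in> T\<close>] by simp
        then have "1 \<le> ennreal (\<integral>x. Y i x \<partial>Q i)"
          by simp
        then show ?thesis
          using mult_left_mono[of 1 "ennreal (\<integral>x. Y i x \<partial>Q i)" "ennreal (\<alpha> / L i w)"] by simp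
      qed
      also have "ennreal (\<integral>x. Y i x \<partial>Q i) = (\<integral>\<^sup>+x. ennreal (Y i x) \<partial>Q i)"
      proof (rule nn_integral_eq_integral[symmetric])
        show "integrable (Q i) (Y i)"
          using Y_nonneg[OF i(2)] Y_le[OF i(2)] Y[OF i(1)]
          by (intro finite_measure.integrable_const_bound[where B=B] prob_space.finite_measure
              Q.prob_space) auto
      qed (use Y_nonneg[OF i(2)] in simp)
      also have "ennreal (\<alpha> / L i w) * \<dots> = (\<integral>\<^sup>+x. ennreal (\<alpha> / L i w) * ennreal (Y i x) \<partial>Q i)"
        using Y[OF i(1)] by (intro nn_integral_cmult[symmetric]) simp
      also have "\<dots> = (\<integral>\<^sup>+x. ennreal (\<alpha> * (Y i ((w(i := x)) i) / L i (w(i := x)))) \<partial>Q i)"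
        using \<open>0 < \<alpha>\<close> L_pos[of i w] Y_nonneg[OF i(2)]
        by (intro nn_integral_cong) (simp add: L_upd ennreal_mult[symmetric])
      finally show ?thesis .
    qed
    have "(\<lambda>v. ennreal (R i v)) \<in> borel_measurable (\<Pi>\<^sub>M i\<in>I. borel)"
      "(\<lambda>v. ennreal (\<alpha> * (Y i (v i) / L i v))) \<in> borel_measurable (\<Pi>\<^sub>M i\<in>I. borel)"
      using i by measurable
    then show ?thesis
      by (simp only: fubini) (intro nn_integral_mono inner)
  qed

  have R_nonneg: "0 \<le> R i v" for i v
    by (simp add: R_def)
  let ?F = "\<lambda>x. fdp T (bh_rejected m \<alpha> mhat (\<lambda>i. p i x))"
  have TI: "T \<subseteq> I"
    using T by (simp add: I_def)
  have F_eq: "?F x = (\<Sum>i\<in>T. R i (\<lambda>i\<in>I. p i x))" for x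
    using TI by (auto simp: fdp_eq intro!: sum.cong R_cong[symmetric])
  have p_meas [measurable]: "(\<lambda>x. \<lambda>i\<in>I. p i x) \<in> measurable M (\<Pi>\<^sub>M i\<in>I. borel)"
    by (intro measurable_restrict p)
  have R_p: "(\<lambda>x. R i (\<lambda>i\<in>I. p i x)) \<in> borel_measurable M" if "i \<in> T" for i
    using measurable_compose[OF p_meas R_meas] that TI by auto
  have F_meas: "?F \<in> borel_measurable M"
    unfolding F_eq using R_p by (intro borel_measurable_sum)
  have "(\<integral>\<^sup>+x. ennreal (?F x) \<partial>M) = (\<Sum>i\<in>T. \<integral>\<^sup>+x. ennreal (R i (\<lambda>i\<in>I. p i x)) \<partial>M)"
    using R_p R_nonneg unfolding F_eq
    by (subst nn_integral_sum[symmetric]) simp_all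
  also have "\<dots> = (\<Sum>i\<in>T. \<integral>\<^sup>+v. ennreal (R i v) \<partial>(\<Pi>\<^sub>M i\<in>I. Q i))"
    using TI unfolding law[symmetric]
    by (intro sum.cong refl nn_integral_distr[symmetric] p_meas) auto
  also have "\<dots> \<le> (\<Sum>i\<in>T. \<integral>\<^sup>+v. ennreal (\<alpha> * (Y i (v i) / L i v)) \<partial>(\<Pi>\<^sub>M i\<in>I. Q i))"
    by (intro sum_mono main)
  \<comment> \<open>Once the sum stands under the integral, \<open>sum_leave_one_out_le_1\<close>
    applies at each point.\<close>
  also have "\<dots> = (\<integral>\<^sup>+v. (\<Sum>i\<in>T. ennreal (\<alpha> * (Y i (v i) / L i v))) \<partial>(\<Pi>\<^sub>M i\<in>I. Q i))"
  proof (rule nn_integral_sum[symmetric])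
    fix i assume "i \<in> T"
    then have [simp]: "i \<in> I"
      using TI by blast
    have "(\<lambda>v. ennreal (\<alpha> * (Y i (v i) / L i v))) \<in> borel_measurable (\<Pi>\<^sub>M i\<in>I. borel)"
      by measurable
    then show "(\<lambda>v. ennreal (\<alpha> * (Y i (v i) / L i v))) \<in> borel_measurable (\<Pi>\<^sub>M i\<in>I. Q i)"
      by (simp add: measurable_cong_sets[OF PiM_Q refl])
  qed
  also have "\<dots> \<le> (\<integral>\<^sup>+v. ennreal \<alpha> \<partial>(\<Pi>\<^sub>M i\<in>I. Q i))"
  proof (intro nn_integral_mono)
    fix v
    have "(\<Sum>i\<in>T. ennreal (\<alpha> * (Y i (v i) / L i v)))
        = ennreal (\<alpha> * (\<Sum>i\<in>T. Y i (v i) / L i v))"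
      using TI \<open>0 < \<alpha>\<close> Y_nonneg L_pos
      by (subst sum_ennreal) (auto simp: sum_distrib_left I_def less_imp_le)
    also have "\<dots> \<le> ennreal (\<alpha> * 1)"
      unfolding L_def using Y_nonneg Y_le \<open>0 < B\<close> \<open>0 < \<alpha>\<close> \<open>finite I\<close> TI
      by (intro ennreal_leI mult_left_mono sum_leave_one_out_le_1) (auto simp: I_def)
    finally show "(\<Sum>i\<in>T. ennreal (\<alpha> * (Y i (v i) / L i v))) \<le> ennreal \<alpha>"
      by simp
  qed
  also have "\<dots> = ennreal \<alpha>"
    by (simp add: Q.emeasure_space_1)
  finally have F_le: "(\<integral>\<^sup>+x. ennreal (?F x) \<partial>M) \<le> ennreal \<alpha>" .
  have F_nonneg: "0 \<le> ?F x" for x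
    by (simp add: fdp_def)
  \<comment> \<open>Finiteness of the nonnegative integral gives integrability, and with it the
    bound passes to the Bochner integral.\<close>
  show int: "integrable M ?F"
    using F_meas F_nonneg F_le by (intro integrableI_nonneg) (auto simp: le_less_trans)
  have "ennreal (expectation ?F) \<le> ennreal \<alpha>"
    using F_le int F_nonneg by (simp add: nn_integral_eq_integral)
  then show "expectation ?F \<le> \<alpha>"
    using \<open>0 < \<alpha>\<close> by (simp add: ennreal_le_iff)
qed

section \<open>Comparison of the scaling factors\<close>

text \<open>A member of \<open>classG\<close> is constrained on \<open>[0,1]\<close> only; composed with \<open>clamp01\<close> it becomes
  monotone, hence Borel, on the whole line.\<close>

definition clamp01 :: "real \<Rightarrow> real" where
  "clamp01 u = max 0 (min 1 u)"

lemma clamp01_in: "clamp01 u \<in> {0..1}"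
  by (simp add: clamp01_def)

lemma clamp01_id: "u \<in> {0..1} \<Longrightarrow> clamp01 u = u"
  by (simp add: clamp01_def)

lemma clamp01_mono: "u \<le> v \<Longrightarrow> clamp01 u \<le> clamp01 v"
  by (auto simp: clamp01_def)

lemma prob_space_unif01: "prob_space unif01"
  unfolding unif01_def
  by (rule prob_space_restrict_space)
    (auto intro!: prob_space_uniform_measure simp: emeasure_uniform_measure)

text \<open>\<open>{0..min t 1}\<close> is the trace of \<open>{..t}\<close> on the unit interval,
  empty for negative \<open>t\<close>; its mass is the uniform distribution function.\<close>

lemma measure_unif01: "measure unif01 {0..min t 1} = clamp01 t"
proof -
  have "measure unif01 {0..min t 1} = measure (uniform_measure lborel {0..1}) {0..min t 1}"
    unfolding unif01_def by (intro measure_restrict_space) auto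
  also have "\<dots> = measure lborel ({0..1} \<inter> {0..min t 1})"
    by (subst measure_uniform_measure) auto
  also have "{0..1} \<inter> {0..min t 1} = {0..min t 1}"
    by auto
  also have "measure lborel {0..min t 1} = clamp01 t"
    by (cases "0 \<le> t") (auto simp: clamp01_def)
  finally show ?thesis .
qed

text \<open>\<open>unif01\<close> lives on the unit interval; its image under the identity is a
  Borel law on the whole line, as \<open>integral_le_of_cdf_le\<close> requires.\<close>

lemma real_distribution_unif01: "real_distribution (distr unif01 borel (\<lambda>x. x))"
  and cdf_unif01: "cdf (distr unif01 borel (\<lambda>x. x)) t = clamp01 t"
  and integral_unif01:
    "g \<in> borel_measurable borel \<Longrightarrow> (\<integral>x. g x \<partial>distr unif01 borel (\<lambda>x. x)) = nu g"
proof -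
  have [measurable]: "(\<lambda>x. x) \<in> borel_measurable unif01"
    unfolding unif01_def by (intro measurable_restrict_space1) simp
  show "real_distribution (distr unif01 borel (\<lambda>x. x))"
    by (rule prob_space.real_distribution_distr[OF prob_space_unif01]) simp
  have "space unif01 = {0..1}"
    by (simp add: unif01_def space_restrict_space)
  then show "cdf (distr unif01 borel (\<lambda>x. x)) t = clamp01 t"
    by (simp add: cdf_def measure_distr measure_unif01)
  show "(\<integral>x. g x \<partial>distr unif01 borel (\<lambda>x. x)) = nu g" if "g \<in> borel_measurable borel"
    using that by (simp add: integral_distr nu_def)
qed

lemma nu_clamp01: "nu (\<lambda>u. g (clamp01 u)) = nu g"
  unfolding nu_def
  by (intro Bochner_Integration.integral_cong)
    (auto simp: unif01_def space_restrict_space clamp01_id)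

text \<open>In a pmf all sets are measurable; the image under the identity restricts it to the Borel
  sets.\<close>

lemma real_distribution_distr_pmf: "real_distribution (distr (measure_pmf D) borel (\<lambda>x. x))"
  by (rule prob_space.real_distribution_distr[OF prob_space_measure_pmf]) simp

lemma cdf_distr_pmf: "cdf (distr (measure_pmf D) borel (\<lambda>x. x)) t = cdf (measure_pmf D) t"
  by (simp add: cdf_def measure_distr)

lemma integral_distr_pmf:
  fixes g :: "real \<Rightarrow> real"
  assumes "g \<in> borel_measurable borel"
  shows "(\<integral>x. g x \<partial>distr (measure_pmf D) borel (\<lambda>x. x)) = measure_pmf.expectation D g"
  using assms by (intro integral_distr) simp_all

lemma cdf_pmf_eq_0: "set_pmf D \<subseteq> {0<..1} \<Longrightarrow> t < 0 \<Longrightarrow> cdf (measure_pmf D) t = 0"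
  by (force simp: cdf_def measure_pmf_zero_iff)

lemma cdf_pmf_eq_1: "set_pmf D \<subseteq> {0<..1} \<Longrightarrow> 1 \<le> t \<Longrightarrow> cdf (measure_pmf D) t = 1"
  unfolding cdf_def by (subst measure_pmf.prob_eq_1) (auto simp: AE_measure_pmf_iff)

text \<open>A real supremum is known to bound its members only if the set is bounded above;
  probabilities are bounded by 1.\<close>

lemma prob_le_null_cdf:
  assumes "\<And>P. P \<in> \<P> \<Longrightarrow> prob_space P" "P \<in> \<P>" "i \<in> true_nulls m H P"
  shows "measure P {x \<in> space P. p i x \<le> t} \<le> null_cdf \<P> m H p i t"
  unfolding null_cdf_def using assms
  by (intro cSUP_upper bdd_aboveI2[where M=1]) (auto intro: prob_space.prob_le_1)

lemma clamp01_comp: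
  fixes g :: "real \<Rightarrow> real"
  assumes "g \<in> {0..1} \<rightarrow> {0..1}" "mono_on {0..1} g"
  shows "mono (\<lambda>u. g (clamp01 u))" "0 \<le> g (clamp01 u)" "g (clamp01 u) \<le> 1"
    "(\<lambda>u. g (clamp01 u)) \<in> borel_measurable borel"
proof -
  show "mono (\<lambda>u. g (clamp01 u))"
    by (intro monoI mono_onD[OF assms(2)] clamp01_in clamp01_mono)
  then show "(\<lambda>u. g (clamp01 u)) \<in> borel_measurable borel"
    by (rule borel_measurable_mono)
  have "g (clamp01 u) \<in> {0..1}"
    using assms(1) clamp01_in by blast
  then show "0 \<le> g (clamp01 u)" "g (clamp01 u) \<le> 1"
    by auto
qed

lemma nu_resc_clamp01:
  assumes "set_pmf (D i) \<subseteq> {0<..1}"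
  shows "nu_resc (\<lambda>u. g (clamp01 u)) D i = nu_resc g D i"
proof -
  have "g (clamp01 u) = g u" if "u \<in> set_pmf (D i)" for u
    using that assms by (subst clamp01_id) auto
  then show ?thesis
    unfolding nu_resc_def by (intro integral_cong_AE) (auto simp: AE_measure_pmf_iff)
qed

text \<open>Super-uniformity puts the cdf of \<open>D i\<close> below the uniform one, so
  \<open>D i\<close> dominates the uniform law stochastically.\<close>

lemma nu_le_nu_resc:
  assumes g: "g \<in> {0..1} \<rightarrow> {0..1}" "mono_on {0..1} g"
    and supp: "set_pmf (D i) \<subseteq> {0<..1}"
    and super: "\<And>t. t \<in> {0..1} \<Longrightarrow> cdf (measure_pmf (D i)) t \<le> t"
  shows "nu g \<le> nu_resc g D i"
proof -
  \<comment> \<open>The comparison of integrals needs every real \<open>t\<close>: below 0 the left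
    side is 0, above 1 the right side is 1.\<close>
  have "cdf (measure_pmf (D i)) t \<le> clamp01 t" for t
  proof -
    consider "t < 0" | "t \<in> {0..1}" | "1 < t"
      by fastforce
    then show ?thesis
    proof cases
      case 1
      then show ?thesis
        using cdf_pmf_eq_0[OF supp] by (simp add: clamp01_def)
    next
      case 2
      then show ?thesis
        using super by (simp add: clamp01_id)
    qed (simp add: cdf_def clamp01_def)
  qed
  then have "(\<integral>x. g (clamp01 x) \<partial>distr unif01 borel (\<lambda>x. x))
      \<le> (\<integral>x. g (clamp01 x) \<partial>distr (measure_pmf (D i)) borel (\<lambda>x. x))"
    by (intro integral_le_of_cdf_le real_distribution_unif01 real_distribution_distr_pmf
        clamp01_comp[OF g]) (simp add: cdf_unif01 cdf_distr_pmf)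
  then show ?thesis
    by (simp add: integral_unif01 integral_distr_pmf clamp01_comp[OF g] nu_clamp01
        nu_resc_def[symmetric] nu_resc_clamp01[where D=D, OF supp])
qed

text \<open>By \<open>dom\<close> the law of \<open>X\<close> dominates \<open>D i\<close>. For a
  null p-value \<open>dom\<close> holds because \<open>null_cdf\<close> is a supremum over all
  distributions satisfying that null.\<close>

lemma (in prob_space) nu_resc_le_expectation:
  assumes g: "g \<in> {0..1} \<rightarrow> {0..1}" "mono_on {0..1} g"
    and X [measurable]: "random_variable borel X" and "\<And>x. x \<in> space M \<Longrightarrow> X x \<in> {0..1}"
    and supp: "set_pmf (D i) \<subseteq> {0<..1}"
    and dom: "\<And>t. t \<in> {0..1} \<Longrightarrow> prob {x \<in> space M. X x \<le> t} \<le> cdf (measure_pmf (D i)) t"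
  shows "nu_resc g D i \<le> expectation (\<lambda>x. g (clamp01 (X x)))"
proof -
  have cdf_X: "cdf (distr M borel X) t = prob {x \<in> space M. X x \<le> t}" for t
    by (simp add: cdf_def measure_distr vimage_def Int_def conj_commute)
  have "prob {x \<in> space M. X x \<le> t} \<le> cdf (measure_pmf (D i)) t" for t
  proof -
    consider "t < 0" | "t \<in> {0..1}" | "1 < t"
      by fastforce
    then show ?thesis
    proof cases
      case 1
      then have "{x \<in> space M. X x \<le> t} = {}"
        using assms(4) by fastforce
      then show ?thesis
        by (simp only: measure_empty cdf_def measure_nonneg)
    next
      case 3
      then show ?thesis
        using cdf_pmf_eq_1[OF supp] by simp
    qed (rule dom)
  qed
  then have "(\<integral>x. g (clamp01 x) \<partial>distr (measure_pmf (D i)) borel (\<lambda>x. x))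
      \<le> (\<integral>x. g (clamp01 x) \<partial>distr M borel X)"
    by (intro integral_le_of_cdf_le real_distribution_distr_pmf real_distribution_distr X
        clamp01_comp[OF g]) (simp add: cdf_X cdf_distr_pmf)
  then show ?thesis
    by (simp add: integral_distr integral_distr_pmf clamp01_comp[OF g]
        nu_resc_def[symmetric] nu_resc_clamp01[where D=D, OF supp])
qed

section \<open>Application to the rescaled estimator\<close>

theorem proposition3p1:
  fixes N :: "'x measure"
    and \<P> :: "'x measure set"
    and m :: nat
    and H :: "nat \<Rightarrow> 'x measure \<Rightarrow> bool"
    and p :: "nat \<Rightarrow> 'x \<Rightarrow> real"
    and D :: "nat \<Rightarrow> real pmf"
    and g :: "real \<Rightarrow> real"
    and \<alpha> :: real
  assumes "m \<ge> 1"
    and model: "\<And>P. P \<in> \<P> \<Longrightarrow> prob_space P \<and> sets P = sets N"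
    and pval_measurable: "\<And>i. i \<in> {1..m} \<Longrightarrow> p i \<in> borel_measurable N"
    and pval_range: "\<And>i x. i \<in> {1..m} \<Longrightarrow> x \<in> space N \<Longrightarrow> p i x \<in> {0..1}"
    and indep: "\<And>P. P \<in> \<P> \<Longrightarrow> prob_space.indep_vars P (\<lambda>_. borel) p {1..m}"
    and discrete_support: "\<And>i. i \<in> {1..m} \<Longrightarrow>
           finite (set_pmf (D i)) \<and> set_pmf (D i) \<subseteq> {0<..1}"
    and discrete_cdf: "\<And>i t. i \<in> {1..m} \<Longrightarrow> t \<in> {0..1} \<Longrightarrow>
           null_cdf \<P> m H p i t = cdf (measure_pmf (D i)) t"
    and super_uniform: "\<And>i t. i \<in> {1..m} \<Longrightarrow> t \<in> {0..1} \<Longrightarrow> null_cdf \<P> m H p i t \<le> t"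
    and "0 < \<alpha>" and "\<alpha> < 1"
    and "g \<in> classG"
  shows "controls_FDR \<P> m H p (bh_rejected m \<alpha> (m0_resc g D m)) \<alpha> \<and>
         (\<forall>P\<in>\<P>. AE x in P. m0_resc g D m (\<lambda>i. p i x) \<le> m0_hat g m (\<lambda>i. p i x))"
proof -
  define \<nu> where "\<nu> = nu_resc g D"
  \<comment> \<open>For \<open>j\<close> in \<open>{1..m}\<close>, dividing by
    \<open>\<nu> j\<close> normalises the mean under \<open>D j\<close> to 1; clamping gives
    monotonicity on the whole line.\<close>
  define Y where "Y = (\<lambda>j u. g (clamp01 u) / \<nu> j)"
  define B where "B = 1 / Min (\<nu> ` {1..m})"
  define mhat where "mhat = (\<lambda>v. B + (\<Sum>j=1..m. Y j (v j)))"
  have g: "g \<in> {0..1} \<rightarrow> {0..1}" "mono_on {0..1} g" and nu_pos: "0 < nu g"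
    using \<open>g \<in> classG\<close> by (auto simp: classG_def)
  have supp: "set_pmf (D i) \<subseteq> {0<..1}" if "i \<in> {1..m}" for i
    using discrete_support[OF that] by blast
  have nu_le: "nu g \<le> \<nu> i" if "i \<in> {1..m}" for i
    unfolding \<nu>_def
  proof (rule nu_le_nu_resc[where D=D, OF g supp[OF that]])
    show "cdf (measure_pmf (D i)) t \<le> t" if "t \<in> {0..1}" for t
      using super_uniform[OF \<open>i \<in> {1..m}\<close> that] discrete_cdf[OF \<open>i \<in> {1..m}\<close> that] by simp
  qed
  have \<nu>_pos: "0 < \<nu> i" if "i \<in> {1..m}" for i
    using nu_le[OF that] nu_pos by linarith
  have "{1..m} \<noteq> {}"
    using \<open>1 \<le> m\<close> by simp
  then have Min_ge: "nu g \<le> Min (\<nu> ` {1..m})"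
    using nu_le by (intro Min.boundedI) auto
  then have Min_pos: "0 < Min (\<nu> ` {1..m})"
    using nu_pos by linarith
  \<comment> \<open>As \<open>g\<close> is at most 1, the reciprocal of the least
    \<open>\<nu> j\<close> dominates every \<open>Y j\<close>; this is why it is the constant term
    of the estimator.\<close>
  have Y_le: "Y j u \<le> B" if "j \<in> {1..m}" for j u
  proof -
    have "Min (\<nu> ` {1..m}) \<le> \<nu> j"
      using that by (intro Min_le) auto
    then show ?thesis
      unfolding Y_def B_def using clamp01_comp(2,3)[OF g] Min_pos by (intro frac_le) auto
  qed
  have Y_nonneg: "0 \<le> Y j u" if "j \<in> {1..m}" for j u
    unfolding Y_def using clamp01_comp(2)[OF g] \<nu>_pos[OF that] by simp
  have Y_mono: "mono (Y j)" if "j \<in> {1..m}" for j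
    unfolding Y_def using monoD[OF clamp01_comp(1)[OF g]] \<nu>_pos[OF that]
    by (intro monoI divide_right_mono) auto
  have m0_eq: "m0_resc g D m v = mhat v" if "\<And>j. j \<in> {1..m} \<Longrightarrow> v j \<in> {0..1}" for v
    using that by (simp add: m0_resc_def mhat_def B_def Y_def \<nu>_def clamp01_id)
  have fdr: "integrable P (\<lambda>x. fdp (true_nulls m H P) (bh_rejected m \<alpha> (m0_resc g D m) (\<lambda>i. p i x)))
      \<and> (\<integral>x. fdp (true_nulls m H P) (bh_rejected m \<alpha> (m0_resc g D m) (\<lambda>i. p i x)) \<partial>P) \<le> \<alpha>"
    if P: "P \<in> \<P>" for P
  proof -
    interpret P: prob_space P
      using model[OF P] by blast
    have sets_P: "sets P = sets N"
      using model[OF P] by blast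
    then have space_P: "space P = space N"
      by (rule sets_eq_imp_space_eq)
    have p_meas: "p i \<in> borel_measurable P" if "i \<in> {1..m}" for i
      using pval_measurable[OF that] by (simp add: measurable_cong_sets[OF sets_P refl])
    have p_range: "p i x \<in> {0..1}" if "i \<in> {1..m}" "x \<in> space P" for i x
      using pval_range that space_P by simp
    let ?T = "true_nulls m H P"
    have T: "?T \<subseteq> {1..m}"
      by (auto simp: true_nulls_def)
    have prob_le: "P.prob {x \<in> space P. p i x \<le> t} \<le> null_cdf \<P> m H p i t" if "i \<in> ?T" for i t
      using model P that by (intro prob_le_null_cdf) auto
    \<comment> \<open>Rejection thresholds may exceed 1, while super-uniformity is assumed on the
      unit interval; beyond 1 the bound is trivial.\<close>
    have super: "P.prob {x \<in> space P. p i x \<le> t} \<le> t" if "i \<in> ?T" "0 \<le> t" for i t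
    proof (cases "t \<le> 1")
      case True
      then show ?thesis
        using prob_le[OF that(1), of t] super_uniform[of i t] that T by force
    next
      case False
      then show ?thesis
        using P.prob_le_1[of "{x \<in> space P. p i x \<le> t}"] by linarith
    qed
    have mean: "1 \<le> P.expectation (\<lambda>x. Y i (p i x))" if "i \<in> ?T" for i
    proof -
      have i: "i \<in> {1..m}"
        using that T by blast
      have "\<nu> i \<le> P.expectation (\<lambda>x. g (clamp01 (p i x)))"
        unfolding \<nu>_def
      proof (rule P.nu_resc_le_expectation[where D=D, OF g p_meas[OF i] p_range[OF i] supp[OF i]])
        show "P.prob {x \<in> space P. p i x \<le> t} \<le> cdf (measure_pmf (D i)) t" if "t \<in> {0..1}" for t
          using prob_le[OF \<open>i \<in> ?T\<close>, of t] discrete_cdf[OF i that] by simp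
      qed
      then show ?thesis
        using \<nu>_pos[OF i] by (simp add: Y_def)
    qed
    \<comment> \<open>The procedure evaluates the estimator only at the observed vector, where all
      p-values are in the unit interval and clamping changes nothing.\<close>
    have eq: "bh_rejected m \<alpha> (m0_resc g D m) (\<lambda>i. p i x) = bh_rejected m \<alpha> mhat (\<lambda>i. p i x)"
      if "x \<in> space P" for x
      using m0_eq[of "\<lambda>i. p i x"] p_range that by (simp add: bh_rejected_def bh_count_def)
    have "0 < B"
      using Min_pos by (simp add: B_def)
    note * = P.plug_in_bh_FDR_le[OF \<open>1 \<le> m\<close> indep[OF P] Y_mono Y_nonneg Y_le \<open>0 < B\<close> \<open>0 < \<alpha>\<close> T
        super mean mhat_def]
    show ?thesis
      using * by (simp add: eq cong: Bochner_Integration.integrable_cong Bochner_Integration.integral_cong)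
  qed
  \<comment> \<open>Each \<open>\<nu> j\<close>, and so their minimum, is at least
    \<open>nu g\<close>: the comparison is termwise and holds for every outcome, which gives the
    almost sure statement.\<close>
  have m0_le: "m0_resc g D m v \<le> m0_hat g m v" if v: "\<And>j. j \<in> {1..m} \<Longrightarrow> v j \<in> {0..1}" for v
  proof -
    have "g (v j) / \<nu> j \<le> g (v j) / nu g" if "j \<in> {1..m}" for j
    proof -
      have "0 \<le> g (v j)"
        using g(1) v[OF that] by fastforce
      then show ?thesis
        using nu_le[OF that] nu_pos \<nu>_pos[OF that] by (intro divide_left_mono) auto
    qed
    then have "(\<Sum>j=1..m. g (v j) / \<nu> j) \<le> (\<Sum>j=1..m. g (v j) / nu g)"
      by (intro sum_mono)
    moreover have "1 / Min (\<nu> ` {1..m}) \<le> 1 / nu g"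
      using Min_ge Min_pos nu_pos by (intro divide_left_mono) auto
    ultimately show ?thesis
      unfolding m0_resc_def m0_hat_def \<nu>_def[symmetric]
      by (simp add: sum_divide_distrib[symmetric] add_divide_distrib)
  qed
  have "AE x in P. m0_resc g D m (\<lambda>i. p i x) \<le> m0_hat g m (\<lambda>i. p i x)" if P: "P \<in> \<P>" for P
    using model[OF P] pval_range m0_le sets_eq_imp_space_eq[of P N] by (intro AE_I2) auto
  with fdr show ?thesis
    unfolding controls_FDR_def by blast
qed

end
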